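(* Suppose that each problem $(P_J^* )$, $J\in\mathcal{P}$, is either infeasible or has a global optimizer, that all of them are solved globally (infeasibility being correctly detected, and for each feasible one the optimal value $\vartheta_J^*$ and some global optimizer $(u_J^*,v_J^* )$ being obtained), and that the set $\mathcal{J}_0$ of indices of feasible branch problems is nonempty. Let $F_{min},\mathcal{J}_1,\mathcal{J}_2$ be the output of the algorithm described in the context. Then $F_{min}$ is the optimal value of the bilevel problem. Moreover, for $J\in\mathcal{J}_0$, the point $(u_J^*,v_J^* )$ is a global optimizer of the bilevel problem if and only if $J\in\mathcal{J}_1$, and it is a local optimizer that is not a global optimizer of the bilevel problem if $J\in\mathcal{J}_2$.
   Context: Let $n,p,m$ be positive integers, $[m]=\{1,\dots,m\}$, and let $\mathcal{I}_1$ be a finite (possibly empty) index set. Let $F,f,h_i$ ($i\in\mathcal{I}_1$) be real polynomials in $(x,y)\in\mathbb{R}^n\times\mathbb{R}^p$, let $a_1,\dots,a_m\in\mathbb{R}^p$ be constant vectors and $b_1,\dots,b_m$ real polynomials in $x\in\mathbb{R}^n$. Let $A\in\mathbb{R}^{m\times p}$ be the matrix with rows $a_1^T,\dots,a_m^T$, $b(x)=(b_1(x),\dots,b_m(x))^T$, and $t=\operatorname{rank}A$. For $x\in\mathbb{R}^n$ let $Z(x)=\{y\in\mathbb{R}^p : Ay-b(x)\ge 0\}$ and let $S(x)$ be the set of global minimizers of $f(x,\cdot)$ over $Z(x)$. Put $$\mathcal{U}=\{(x,y) : h_i(x,y)\ge 0\ (i\in\mathcal{I}_1),\ a_j^Ty-b_j(x)\ge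 0\ (j\in[m])\},\qquad \mathcal{F}=\{(x,y)\in\mathcal{U} : y\in S(x)\}.$$ The bilevel problem is: minimize $F(x,y)$ over $(x,y)\in\mathcal{F}$. A point of $\mathcal{F}$ is a global (resp. local) optimizer if it minimizes $F$ over $\mathcal{F}$ (resp. over $\mathcal{F}\cap B$ for some ball $B$ of positive radius centered at the point). Standing assumption: $S(x)\neq\emptyset$ for every $x$ such that $(x,y)\in\mathcal{U}$ for some $y$. For $J\subseteq[m]$, $A_J$ denotes the submatrix of $A$ with rows $a_j^T$, $j\in J$. Let $\mathcal{P}=\{J\subseteq[m] : |J|=t,\ A_J\text{ has full rank}\}$. For $J\in\mathcal{P}$, $\mathcal{K}_J$ is the set of all $(x,y)\in\mathcal{U}$ for which there exists $\lambda_J=(\lambda_j)_{j\in J}$ with $\nabla_yf(x,y)-A_J^T\lambda_J=0$ and, for all $j\in J$, $a_j^Ty-b_j(x)\ge0$, $\lambda_j\ge0$, $\lambda_j\,(a_j^Ty-b_j(x))=0$. The active index set at $(x,y)$ is $\mathcal{I}(x,y)=\{j\in[m] : a_j^Ty=b_j(x)\}$. For $J\in\mathcal{P}$, the branch problem $(P_J^* )$ is: minimize $F(x,y)$ over $(x,y)\in\mathcal{K}_J\cap\mathcal{F}$; its optimal value is $\vartheta_J^*$. The algorithm: solve $(P_J^* )$ for every $J\in\mathcal{P}$; let $\mathcal{J}_0$ be the set of $J\in\mathcal{P}$ for which $(P_J^* )$ is feasible, and for each $J\in\mathcal{J}_0$ record $\vartheta_J^*$ and one global optimizer $(u_J^*,v_J^*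 )$ of $(P_J^* )$. If $\mathcal{J}_0=\emptyset$, report that the bilevel problem is infeasible. Otherwise output $$F_{min}=\min\{\vartheta_J^* : J\in\mathcal{J}_0\},\qquad \mathcal{J}_1=\{J\in\mathcal{J}_0 : \vartheta_J^*=F_{min}\},$$ $$\mathcal{J}_2=\{J\in\mathcal{J}_0\setminus\mathcal{J}_1 : \vartheta_J^*\le\vartheta_{J'}^*\text{ for all }J'\in\mathcal{J}_0\text{ with }J'\subseteq\mathcal{I}(u_J^*,v_J^* )\cup J\}.$$ *)

theory Defs
  imports "HOL-Analysis.Analysis"
begin

section \<open>Optimization problems\<close>

definition global_optimizer :: "('a \<Rightarrow> real) \<Rightarrow> 'a set \<Rightarrow> 'a \<Rightarrow> bool" where
  "global_optimizer g C z \<longleftrightarrow> z \<in> C \<and> (\<forall>w\<in>C. g z \<le> g w)"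

definition local_optimizer :: "('a::metric_space \<Rightarrow> real) \<Rightarrow> 'a set \<Rightarrow> 'a \<Rightarrow> bool" where
  "local_optimizer g C z \<longleftrightarrow> z \<in> C \<and> (\<exists>r>0. global_optimizer g (C \<inter> ball z r) z)"

text \<open>The infimum is taken in the extended reals: \<open>\<infinity>\<close> if the problem is infeasible,
  \<open>-\<infinity>\<close> if it is unbounded below.\<close>

definition optimal_value :: "('a \<Rightarrow> real) \<Rightarrow> 'a set \<Rightarrow> ereal" where
  "optimal_value g C = (INF z\<in>C. ereal (g z))"

text \<open>This is the gradient wherever \<open>g\<close> is differentiable, in particular for polynomials.\<close>

definition gradient :: "('a::real_inner \<Rightarrow> real) \<Rightarrow> 'a \<Rightarrow> 'a" where
  "gradient g y = (THE D. GDERIV g y :> D)"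


section \<open>The bilevel problem\<close>

text \<open>The lower-level constraint indices \<open>{1,\<dots>,m}\<close> are the elements of the finite index type
  \<open>'m\<close>, and \<open>a\<^sub>j\<close> is \<open>row j A\<close>. Polynomials in \<open>(x,y)\<close> are functions on \<open>real^'n \<times> real^'p\<close>.\<close>

definition lower_set :: "real^'p^'m \<Rightarrow> (real^'n \<Rightarrow> real^'m) \<Rightarrow> real^'n \<Rightarrow> (real^'p) set" where
  "lower_set A b x = {y. \<forall>j. (A *v y - b x) $ j \<ge> 0}"

definition lower_solutions ::
  "((real^'n) \<times> (real^'p) \<Rightarrow> real) \<Rightarrow> real^'p^'m \<Rightarrow> (real^'n \<Rightarrow> real^'m) \<Rightarrow> real^'n \<Rightarrow> (real^'p) set" where
  "lower_solutions f A b x = {y. global_optimizer (\<lambda>y'. f (x, y')) (lower_set A b x) y}"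

definition constraint_set ::
  "'i set \<Rightarrow> ('i \<Rightarrow> (real^'n) \<times> (real^'p) \<Rightarrow> real) \<Rightarrow> real^'p^'m \<Rightarrow> (real^'n \<Rightarrow> real^'m)
    \<Rightarrow> ((real^'n) \<times> (real^'p)) set" where
  "constraint_set I1 h A b =
    {(x, y). (\<forall>i\<in>I1. h i (x, y) \<ge> 0) \<and> (\<forall>j. row j A \<bullet> y - b x $ j \<ge> 0)}"

definition bilevel_feasible ::
  "((real^'n) \<times> (real^'p) \<Rightarrow> real) \<Rightarrow> 'i set \<Rightarrow> ('i \<Rightarrow> (real^'n) \<times> (real^'p) \<Rightarrow> real)
    \<Rightarrow> real^'p^'m \<Rightarrow> (real^'n \<Rightarrow> real^'m) \<Rightarrow> ((real^'n) \<times> (real^'p)) set" where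
  "bilevel_feasible f I1 h A b =
    {(x, y). (x, y) \<in> constraint_set I1 h A b \<and> y \<in> lower_solutions f A b x}"

definition active_set ::
  "real^'p^'m \<Rightarrow> (real^'n \<Rightarrow> real^'m) \<Rightarrow> (real^'n) \<times> (real^'p) \<Rightarrow> 'm set" where
  "active_set A b = (\<lambda>(x, y). {j. row j A \<bullet> y = b x $ j})"


section \<open>Branch problems\<close>

text \<open>The rank of the submatrix \<open>A\<^sub>J\<close>, as the dimension of the span of its rows. As \<open>J\<close> is not a
  type, \<open>A\<^sub>J\<close> itself has no matrix type; for \<open>J = UNIV\<close> this is the library's \<open>rank\<close>.\<close>

definition submatrix_rank :: "real^'p^'m \<Rightarrow> 'm set \<Rightarrow> nat" where
  "submatrix_rank A J = dim ((\<lambda>j. row j A) ` J)"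

lemma submatrix_rank_UNIV: "submatrix_rank A UNIV = rank A"
  by (simp add: submatrix_rank_def row_rank_def rows_def full_SetCompr_eq)

text \<open>\<open>A\<^sub>J\<close> has \<open>card J\<close> rows and \<open>CARD('p)\<close> columns.\<close>

definition branch_indices :: "real^'p^'m \<Rightarrow> 'm set set" where
  "branch_indices A =
    {J. card J = rank A \<and> submatrix_rank A J = min (card J) CARD('p)}"

text \<open>Only the values of the multiplier \<open>\<lambda>\<close> on \<open>J\<close> matter; the sum is \<open>A\<^sub>J\<^sup>T \<lambda>\<^sub>J\<close>.\<close>

definition kkt_set ::
  "((real^'n) \<times> (real^'p) \<Rightarrow> real) \<Rightarrow> 'i set \<Rightarrow> ('i \<Rightarrow> (real^'n) \<times> (real^'p) \<Rightarrow> real)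
    \<Rightarrow> real^'p^'m \<Rightarrow> (real^'n \<Rightarrow> real^'m) \<Rightarrow> 'm set \<Rightarrow> ((real^'n) \<times> (real^'p)) set" where
  "kkt_set f I1 h A b J =
    {(x, y). (x, y) \<in> constraint_set I1 h A b \<and>
      (\<exists>l :: 'm \<Rightarrow> real.
        gradient (\<lambda>y'. f (x, y')) y - (\<Sum>j\<in>J. l j *\<^sub>R row j A) = 0 \<and>
        (\<forall>j\<in>J. row j A \<bullet> y - b x $ j \<ge> 0 \<and> l j \<ge> 0 \<and> l j * (row j A \<bullet> y - b x $ j) = 0))}"

definition branch_feasible ::
  "((real^'n) \<times> (real^'p) \<Rightarrow> real) \<Rightarrow> 'i set \<Rightarrow> ('i \<Rightarrow> (real^'n) \<times> (real^'p) \<Rightarrow> real)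
    \<Rightarrow> real^'p^'m \<Rightarrow> (real^'n \<Rightarrow> real^'m) \<Rightarrow> 'm set \<Rightarrow> ((real^'n) \<times> (real^'p)) set" where
  "branch_feasible f I1 h A b J = kkt_set f I1 h A b J \<inter> bilevel_feasible f I1 h A b"


section \<open>Output of the algorithm\<close>

text \<open>The algorithm works with the recorded data: the set \<open>J0\<close> of indices of the feasible branch
  problems and, for \<open>J \<in> J0\<close>, the recorded optimal value \<open>\<theta> J\<close> and optimizer \<open>w J\<close>.\<close>

definition alg_Fmin :: "'m set set \<Rightarrow> ('m set \<Rightarrow> real) \<Rightarrow> real" where
  "alg_Fmin J0 \<theta> = Min (\<theta> ` J0)"

definition alg_J1 :: "'m set set \<Rightarrow> ('m set \<Rightarrow> real) \<Rightarrow> 'm set set" where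
  "alg_J1 J0 \<theta> = {J\<in>J0. \<theta> J = alg_Fmin J0 \<theta>}"

definition alg_J2 ::
  "real^'p^'m \<Rightarrow> (real^'n \<Rightarrow> real^'m) \<Rightarrow> 'm set set \<Rightarrow> ('m set \<Rightarrow> real)
    \<Rightarrow> ('m set \<Rightarrow> (real^'n) \<times> (real^'p)) \<Rightarrow> 'm set set" where
  "alg_J2 A b J0 \<theta> w =
    {J \<in> J0 - alg_J1 J0 \<theta>. \<forall>J'\<in>J0. J' \<subseteq> active_set A b (w J) \<union> J \<longrightarrow> \<theta> J \<le> \<theta> J'}"

end

theory Submission
  imports Defs
begin

text \<open>
  Everything follows from one fact about a bilevel feasible point \<open>(x,y)\<close>: for every branch index
  \<open>J\<close> whatsoever, \<open>(x,y)\<close> is feasible for some branch \<open>J' \<subseteq> \<I>(x,y) \<union> J\<close>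
  (lemma \<open>bilevel_feasible_in_branch_near\<close>). Indeed \<open>y\<close> minimizes \<open>f(x,\<cdot>)\<close> over a polyhedron,
  so by Farkas' lemma the gradient of \<open>f(x,\<cdot>)\<close> at \<open>y\<close> is a nonnegative combination of the
  active rows. By Caratheodory's theorem for cones, linearly independent active rows
  suffice, and these can be completed to a basis of the row space with rows of the basis \<open>J\<close>. The
  indices of this basis form \<open>J'\<close>; the multipliers of the added rows are \<open>0\<close>.

  Consequently the bilevel feasible set is the union of the finitely many branch feasible sets, which
  settles the optimal value and the global optimizers. For the local statement, the active set at a
  feasible point \<open>z\<close> close to \<open>w\<^sub>J = (u\<^sub>J,v\<^sub>J)\<close> is contained in the one at \<open>w\<^sub>J\<close>. Hence \<open>z\<close>
  is feasible for a branch \<open>J' \<subseteq> \<I>(w\<^sub>J) \<union> J\<close>, one of those that the test defining \<open>\<J>\<^sub>2\<close> compares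
  with \<open>J\<close>, and so \<open>F(w\<^sub>J) = \<theta>\<^sub>J \<le> \<theta>\<^sub>J' \<le> F(z)\<close>.
\<close>

section \<open>Finitely generated cones\<close>

lemma convex_cone_hull_finite_explicit:
  fixes S :: "'a::real_vector set"
  assumes "finite S" and "z \<in> convex_cone hull S"
  obtains c where "\<forall>s\<in>S. 0 \<le> c s" and "z = (\<Sum>s\<in>S. c s *\<^sub>R s)"
proof -
  let ?K = "{(\<Sum>s\<in>S. c s *\<^sub>R s) | c. \<forall>s\<in>S. (0::real) \<le> c s}"
  have "S \<subseteq> ?K"
  proof
    fix v assume v: "v \<in> S"
    have "v = (\<Sum>s\<in>S. (if s = v then 1 else 0) *\<^sub>R s)"
      using v assms(1) by (simp add: if_distrib[of "\<lambda>r. r *\<^sub>R _"] sum.delta cong: if_cong)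
    then show "v \<in> ?K" by (intro CollectI exI[of _ "\<lambda>s. if s = v then 1 else 0"]) simp
  qed
  moreover have "convex_cone ?K"
  proof (unfold convex_cone_iff, intro conjI ballI allI impI)
    show "0 \<in> ?K" by (auto intro!: exI[of _ "\<lambda>_. 0"])
  next
    fix p q assume "p \<in> ?K" "q \<in> ?K"
    then obtain c d where "\<forall>s\<in>S. 0 \<le> c s" "p = (\<Sum>s\<in>S. c s *\<^sub>R s)"
      "\<forall>s\<in>S. 0 \<le> d s" "q = (\<Sum>s\<in>S. d s *\<^sub>R s)" by auto
    then show "p + q \<in> ?K"
      by (intro CollectI exI[of _ "\<lambda>s. c s + d s"]) (simp add: scaleR_left_distrib sum.distrib)
  next
    fix p and r :: real assume "p \<in> ?K" "0 \<le> r"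
    then obtain c where "\<forall>s\<in>S. 0 \<le> c s" "p = (\<Sum>s\<in>S. c s *\<^sub>R s)" by auto
    with \<open>0 \<le> r\<close> show "r *\<^sub>R p \<in> ?K"
      by (intro CollectI exI[of _ "\<lambda>s. r * c s"]) (simp add: scaleR_sum_right)
  qed
  ultimately have "convex_cone hull S \<subseteq> ?K" by (rule hull_minimal)
  with assms(2) that show thesis by blast
qed

text \<open>A finitely generated cone is closed, so a point outside it is strictly separated from it. A
  functional bounded below on a cone is nonnegative on it.\<close>

lemma farkas:
  fixes S :: "'a::euclidean_space set"
  assumes "finite S" and pos: "\<And>d. (\<forall>s\<in>S. 0 \<le> s \<bullet> d) \<Longrightarrow> 0 \<le> z \<bullet> d"
  shows "z \<in> convex_cone hull S"
proof (rule ccontr)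
  assume z: "z \<notin> convex_cone hull S"
  obtain d \<beta> where lt: "d \<bullet> z < \<beta>" and gt: "\<And>s. s \<in> convex_cone hull S \<Longrightarrow> \<beta> < d \<bullet> s"
    using separating_hyperplane_closed_point[OF convex_convex_cone_hull
        closed_convex_cone_hull[OF assms(1)] z] by blast
  have "\<beta> < 0" using gt[OF convex_cone_hull_contains_0] by simp
  have "0 \<le> s \<bullet> d" if "s \<in> S" for s
  proof (rule ccontr)
    assume "\<not> 0 \<le> s \<bullet> d"
    then have neg: "d \<bullet> s < 0" by (simp add: inner_commute)
    have "(\<beta> / (d \<bullet> s)) *\<^sub>R s \<in> convex_cone hull S"
      using that neg \<open>\<beta> < 0\<close> by (intro convex_cone_hull_mul hull_inc) (auto simp: divide_nonpos_nonpos)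
    from gt[OF this] neg show False by simp
  qed
  then have "0 \<le> z \<bullet> d" using pos by blast
  with lt \<open>\<beta> < 0\<close> show False by (simp add: inner_commute)
qed

text \<open>If a combination with the fewest terms used linearly dependent vectors, subtracting a suitable
  multiple of the dependence would make one coefficient vanish and keep the others nonnegative.\<close>

lemma conic_caratheodory:
  fixes S :: "'a::euclidean_space set"
  assumes "finite S" and "z \<in> convex_cone hull S"
  obtains T c where "T \<subseteq> S" "independent T" "\<forall>s\<in>T. 0 \<le> c s" "z = (\<Sum>s\<in>T. c s *\<^sub>R s)"
proof -
  define P where "P T c \<longleftrightarrow> T \<subseteq> S \<and> (\<forall>s\<in>T. (0::real) \<le> c s) \<and> z = (\<Sum>s\<in>T. c s *\<^sub>R s)" for T c
  have "\<exists>T. \<exists>c. P T c"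
    using convex_cone_hull_finite_explicit[OF assms] unfolding P_def by blast
  then obtain T where "\<exists>c. P T c" and least: "\<And>U. \<exists>c. P U c \<Longrightarrow> card T \<le> card U"
    using ex_has_least_nat[of "\<lambda>T. \<exists>c. P T c" _ card] by blast
  then obtain c where TS: "T \<subseteq> S" and c: "\<forall>s\<in>T. 0 \<le> c s" and z: "z = (\<Sum>s\<in>T. c s *\<^sub>R s)"
    unfolding P_def by blast
  have fin: "finite T" using TS assms(1) finite_subset by blast
  have "independent T"
  proof (rule ccontr)
    assume "\<not> independent T"
    then obtain e v where "v \<in> T" "e v \<noteq> 0" "(\<Sum>s\<in>T. e s *\<^sub>R s) = 0"
      using dependent_finite[OF fin] by auto
    then obtain e where e0: "(\<Sum>s\<in>T. e s *\<^sub>R s) = 0" and v: "v \<in> T" "0 < e v"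
    proof (cases "0 < e v")
      case False
      with \<open>v \<in> T\<close> \<open>e v \<noteq> 0\<close> \<open>(\<Sum>s\<in>T. e s *\<^sub>R s) = 0\<close> show thesis
        by (intro that[of "\<lambda>s. - e s"]) (auto simp: sum_negf)
    qed blast
    \<comment> \<open>\<open>r\<close> is the longest step along \<open>- e\<close> that keeps all coefficients nonnegative; it is
      attained at \<open>w\<close>, whose coefficient vanishes.\<close>
    define U where "U = {s\<in>T. 0 < e s}"
    define r where "r = Min ((\<lambda>s. c s / e s) ` U)"
    have U: "finite ((\<lambda>s. c s / e s) ` U)" "(\<lambda>s. c s / e s) ` U \<noteq> {}" using fin v by (auto simp: U_def)
    then have "r \<in> (\<lambda>s. c s / e s) ` U" unfolding r_def by (rule Min_in)
    then obtain w where w: "w \<in> T" "0 < e w" "r = c w / e w" by (auto simp: U_def)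
    have "0 \<le> r" using w c by simp
    have nonneg: "0 \<le> c s - r * e s" if "s \<in> T" for s
    proof (cases "0 < e s")
      case True
      then have "r \<le> c s / e s" unfolding r_def using that U by (intro Min_le) (auto simp: U_def)
      with True show ?thesis by (simp add: pos_le_divide_eq)
    next
      case False
      then have "r * e s \<le> 0" using \<open>0 \<le> r\<close> by (simp add: mult_nonneg_nonpos)
      with c that show ?thesis by (metis diff_ge_0_iff_ge order_trans)
    qed
    have "z = (\<Sum>s\<in>T. c s *\<^sub>R s) - r *\<^sub>R (\<Sum>s\<in>T. e s *\<^sub>R s)" using z e0 by simp
    also have "\<dots> = (\<Sum>s\<in>T. (c s - r * e s) *\<^sub>R s)"
      by (simp add: scaleR_sum_right sum_subtractf scaleR_left_diff_distrib)
    also have "\<dots> = (\<Sum>s\<in>T - {w}. (c s - r * e s) *\<^sub>R s)"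
      using w fin by (subst sum.remove[of T w]) auto
    finally have "P (T - {w}) (\<lambda>s. c s - r * e s)" unfolding P_def using TS nonneg by blast
    then have "card T \<le> card (T - {w})" using least by blast
    then show False using fin w(1) card_Diff1_less[of T w] by simp
  qed
  with TS c z that show thesis by blast
qed


section \<open>Optimality conditions under linear constraints\<close>

lemma gradient_eqI:
  assumes "GDERIV g y :> D"
  shows "gradient g y = D"
  unfolding gradient_def
proof (rule the_equality)
  show "GDERIV g y :> D" by (rule assms)
next
  fix D' assume "GDERIV g y :> D'"
  then have "(\<lambda>h. h \<bullet> D') = (\<lambda>h. h \<bullet> D)"
    using assms unfolding gderiv_def by (rule has_derivative_unique)
  then have "(D' - D) \<bullet> D' = (D' - D) \<bullet> D" by meson
  then show "D' = D" by (metis inner_diff_right inner_eq_zero_iff right_minus_eq)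
qed

lemma gderiv_gradient:
  fixes g :: "'a::euclidean_space \<Rightarrow> real"
  assumes "g differentiable at y"
  shows "GDERIV g y :> gradient g y"
proof -
  obtain g' where g': "(g has_derivative g') (at y)"
    using assms by (auto simp: differentiable_def)
  have "GDERIV g y :> adjoint g' 1"
    using g' adjoint_works[OF has_derivative_linear[OF g'], of _ "1::real"]
    by (simp add: gderiv_def)
  then show ?thesis using gradient_eqI by metis
qed

text \<open>Moving from a minimizer in a direction along which the active constraints do not decrease
  stays feasible for a short time, so the objective does not decrease to first order.\<close>

lemma minimizer_polyhedron_directional:
  fixes g :: "real^'p \<Rightarrow> real" and A :: "real^'p^'m"
  assumes diff: "g differentiable at y"
    and min: "global_optimizer g {y. \<forall>j. (A *v y - \<beta>) $ j \<ge> 0} y"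
    and d: "\<And>j. row j A \<bullet> y = \<beta> $ j \<Longrightarrow> 0 \<le> row j A \<bullet> d"
  shows "0 \<le> gradient g y \<bullet> d"
proof (rule ccontr)
  assume neg: "\<not> 0 \<le> gradient g y \<bullet> d"
  have feas_iff: "(A *v w - \<beta>) $ j \<ge> 0 \<longleftrightarrow> \<beta> $ j \<le> row j A \<bullet> w" for w j
    by (simp add: matrix_vector_mul_component row_def vec_nth_inverse)
  have y: "\<beta> $ j \<le> row j A \<bullet> y" for j
    using min by (auto simp: global_optimizer_def feas_iff simp del: vector_minus_component)
  have "((\<lambda>t. g (y + t *\<^sub>R d)) has_derivative (\<lambda>t. (t *\<^sub>R d) \<bullet> gradient g y)) (at 0)"
  proof -
    have "(g has_derivative (\<lambda>k. k \<bullet> gradient g y)) (at (y + 0 *\<^sub>R d))"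
      using gderiv_gradient[OF diff] by (simp add: gderiv_def)
    moreover have "((\<lambda>t. y + t *\<^sub>R d) has_derivative (\<lambda>t. t *\<^sub>R d)) (at 0)"
      by (auto intro!: derivative_eq_intros)
    ultimately show ?thesis by (rule has_derivative_compose[rotated])
  qed
  then have "((\<lambda>t. g (y + t *\<^sub>R d)) has_real_derivative (gradient g y \<bullet> d)) (at 0)"
    by (rule has_derivative_imp_has_field_derivative) (simp add: inner_commute)
  then obtain \<delta> where "0 < \<delta>" and less: "\<And>t. 0 < t \<Longrightarrow> t < \<delta> \<Longrightarrow> g (y + t *\<^sub>R d) < g y"
    using DERIV_neg_dec_right[of "\<lambda>t. g (y + t *\<^sub>R d)" "gradient g y \<bullet> d" 0] neg by auto
  have "\<forall>\<^sub>F t in at_right 0. \<beta> $ j \<le> row j A \<bullet> (y + t *\<^sub>R d)" for j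
  proof (cases "row j A \<bullet> y = \<beta> $ j")
    case True
    then have "\<beta> $ j \<le> row j A \<bullet> (y + t *\<^sub>R d)" if "0 < t" for t
      using d[OF True] that by (simp add: inner_right_distrib)
    then show ?thesis by (auto simp: eventually_at_filter)
  next
    case False
    have "((\<lambda>t. row j A \<bullet> (y + t *\<^sub>R d)) \<longlongrightarrow> row j A \<bullet> (y + 0 *\<^sub>R d)) (at_right 0)"
      by (intro tendsto_intros)
    moreover have "\<beta> $ j < row j A \<bullet> (y + 0 *\<^sub>R d)" using False y[of j] by simp
    ultimately have "\<forall>\<^sub>F t in at_right 0. \<beta> $ j < row j A \<bullet> (y + t *\<^sub>R d)"
      by (rule order_tendstoD(1))
    then show ?thesis by (rule eventually_mono) simp
  qed
  then have "\<forall>\<^sub>F t in at_right 0. \<forall>j. \<beta> $ j \<le> row j A \<bullet> (y + t *\<^sub>R d)"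
    by (rule eventually_all_finite)
  moreover have "\<forall>\<^sub>F t in at_right 0. 0 < t \<and> t < \<delta>"
    using \<open>0 < \<delta>\<close> by (auto simp: eventually_at_right)
  ultimately have "\<forall>\<^sub>F t in at_right (0::real). False"
  proof eventually_elim
    case (elim t)
    then have "y + t *\<^sub>R d \<in> {y. \<forall>j. (A *v y - \<beta>) $ j \<ge> 0}"
      using feas_iff by blast
    then have "g y \<le> g (y + t *\<^sub>R d)" using min unfolding global_optimizer_def by blast
    with less[of t] elim show False by simp
  qed
  then show False by simp
qed

lemma gradient_in_active_cone:
  fixes g :: "real^'p \<Rightarrow> real" and A :: "real^'p^'m"
  assumes "g differentiable at y"
    and "global_optimizer g {y. \<forall>j. (A *v y - \<beta>) $ j \<ge> 0} y"
  shows "gradient g y \<in> convex_cone hull ((\<lambda>j. row j A) ` {j. row j A \<bullet> y = \<beta> $ j})"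
  using minimizer_polyhedron_directional[OF assms] by (intro farkas) auto


section \<open>Exchanging rows between branches\<close>

lemma branch_indices_iff:
  "J \<in> branch_indices A \<longleftrightarrow> card J = rank A \<and> dim ((\<lambda>j. row j A) ` J) = rank A"
  using rank_bound[of A] by (auto simp: branch_indices_def submatrix_rank_def)

text \<open>This is the Steinitz exchange: the rows in \<open>J\<close> span the row space, so they complete \<open>T\<close> to a
  basis of it. Different indices may carry the same row; injectivity on \<open>J'\<close> lets a coefficient of a
  vector in \<open>T\<close> be charged to exactly one index, and that index can be taken in \<open>I\<close>.\<close>

lemma branch_exchange:
  fixes A :: "real^'p^'m"
  assumes J: "J \<in> branch_indices A" and T: "independent T" "T \<subseteq> (\<lambda>j. row j A) ` I"
  obtains J' where "J' \<in> branch_indices A" "J' \<subseteq> I \<union> J" "inj_on (\<lambda>j. row j A) J'"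
    "T \<subseteq> (\<lambda>j. row j A) ` (J' \<inter> I)"
proof -
  let ?r = "\<lambda>j. row j A"
  obtain B where B: "T \<subseteq> B" "B \<subseteq> T \<union> ?r ` J" "independent B" "T \<union> ?r ` J \<subseteq> span B"
    using maximal_independent_subset_extend[of T "T \<union> ?r ` J"] T(1) by blast
  obtain K where K: "K \<subseteq> I" "inj_on ?r K" "T = ?r ` K"
    using T(2) by (auto simp: subset_image_inj)
  have "B - T \<subseteq> ?r ` J" using B(2) by blast
  then obtain L where L: "L \<subseteq> J" "inj_on ?r L" "B - T = ?r ` L"
    by (auto simp: subset_image_inj)
  have im: "?r ` (K \<union> L) = B" using K(3) L(3) B(1) by (auto simp: image_Un)
  have inj: "inj_on ?r (K \<union> L)"
    using K L by (subst inj_on_Un) blast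
  have rows: "rows A = range ?r" by (auto simp: rows_def)
  have "dim (rows A) \<le> dim (?r ` J)"
    using J by (simp add: branch_indices_iff row_rank_def)
  moreover have "dim (?r ` J) \<le> dim B"
    using B(4) dim_subset[of "?r ` J" "span B"] by simp
  moreover have "dim B \<le> dim (rows A)"
    using im by (intro dim_subset) (auto simp: rows)
  ultimately have "dim B = rank A" by (simp add: row_rank_def)
  moreover have "card B = dim B" using B(3) by (simp add: dim_eq_card_independent)
  moreover have "card (K \<union> L) = card B" using card_image[OF inj] im by simp
  ultimately have "K \<union> L \<in> branch_indices A" by (simp add: branch_indices_iff im)
  then show thesis
    using K L inj by (intro that[of "K \<union> L"]) auto
qed

text \<open>The freedom to choose \<open>J\<close> matters twice. With any \<open>J\<close> the lemma says that the branches cover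
  the bilevel feasible set; with the \<open>J\<close> of a candidate local optimizer it locates the branch of each
  nearby feasible point among those that \<open>J\<close> is compared with.\<close>

lemma bilevel_feasible_in_branch_near:
  fixes A :: "real^'p^'m" and f :: "(real^'n) \<times> (real^'p) \<Rightarrow> real"
  assumes f: "real_polynomial_function f"
    and xy: "(x, y) \<in> bilevel_feasible f I1 h A b"
    and J: "J \<in> branch_indices A"
  obtains J' where "J' \<in> branch_indices A" "J' \<subseteq> active_set A b (x, y) \<union> J"
    "(x, y) \<in> branch_feasible f I1 h A b J'"
proof -
  let ?r = "\<lambda>j. row j A"
  define g where "g = (\<lambda>y'. f (x, y'))"
  define I where "I = {j. row j A \<bullet> y = b x $ j}"
  have U: "(x, y) \<in> constraint_set I1 h A b"
    and "global_optimizer g (lower_set A b x) y"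
    using xy by (auto simp: bilevel_feasible_def lower_solutions_def g_def)
  moreover have "g differentiable at y"
    unfolding g_def using differentiable_at_real_polynomial_function[OF f, of "(x, y)" UNIV]
    by (intro differentiable_compose[of f "\<lambda>y'. (x, y')"]) auto
  ultimately have "gradient g y \<in> convex_cone hull (?r ` I)"
    unfolding lower_set_def I_def by (intro gradient_in_active_cone)
  then obtain T c where T: "T \<subseteq> ?r ` I" "independent T"
    and c: "\<forall>s\<in>T. 0 \<le> c s" "gradient g y = (\<Sum>s\<in>T. c s *\<^sub>R s)"
    using conic_caratheodory[of "?r ` I"] by auto
  obtain J' where J': "J' \<in> branch_indices A" "J' \<subseteq> I \<union> J" and inj: "inj_on ?r J'"
    and TJ': "T \<subseteq> ?r ` (J' \<inter> I)"
    using branch_exchange[OF J T(2,1)] by blast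
  \<comment> \<open>Complementarity forces the multiplier to be supported on active indices, hence the
    intersection with \<open>I\<close>.\<close>
  define K where "K = {j \<in> J' \<inter> I. ?r j \<in> T}"
  define l where "l j = (if j \<in> K then c (?r j) else 0)" for j
  have K: "K \<subseteq> J'" "?r ` K = T" using TJ' by (auto simp: K_def)
  have "(\<Sum>j\<in>J'. l j *\<^sub>R ?r j) = (\<Sum>j\<in>K. c (?r j) *\<^sub>R ?r j)"
    using K(1) by (intro sum.mono_neutral_cong_right) (auto simp: l_def)
  also have "\<dots> = (\<Sum>s\<in>T. c s *\<^sub>R s)"
    using inj_on_subset[OF inj K(1)] by (simp add: sum.reindex flip: K(2))
  finally have "gradient g y - (\<Sum>j\<in>J'. l j *\<^sub>R ?r j) = 0" using c(2) by simp
  moreover have "0 \<le> l j \<and> l j * (?r j \<bullet> y - b x $ j) = 0" for j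
    using c(1) by (auto simp: l_def K_def I_def)
  ultimately have "(x, y) \<in> kkt_set f I1 h A b J'"
    using U unfolding kkt_set_def g_def constraint_set_def by blast
  with xy J' that show thesis
    by (auto simp: branch_feasible_def active_set_def I_def)
qed

text \<open>A constraint that is slack at a point is, by continuity, slack nearby; there are finitely many
  constraints.\<close>

lemma eventually_active_set_subset:
  fixes A :: "real^'p^'m" and b :: "real^'n \<Rightarrow> real^'m"
  assumes b: "\<forall>j. real_polynomial_function (\<lambda>x. b x $ j)"
  shows "\<forall>\<^sub>F z in nhds w. active_set A b z \<subseteq> active_set A b w"
proof -
  let ?s = "\<lambda>j z. row j A \<bullet> snd z - b (fst z) $ j"
  have "\<forall>\<^sub>F z in nhds w. ?s j z = 0 \<longrightarrow> ?s j w = 0" for j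
  proof (cases "?s j w = 0")
    case False
    have "isCont (\<lambda>x. b x $ j) (fst w)"
      using b continuous_real_polymonial_function by blast
    then have "isCont (\<lambda>z. b (fst z) $ j) w"
      by (intro isCont_o2[of w fst "\<lambda>x. b x $ j"] isCont_fst continuous_ident)
    then have "isCont (?s j) w"
      by (intro continuous_diff continuous_inner continuous_const continuous_snd continuous_ident)
    then have "(?s j \<longlongrightarrow> ?s j w) (nhds w)" by (simp only: isCont_def tendsto_at_iff_tendsto_nhds[of "?s j" w])
    then have "\<forall>\<^sub>F z in nhds w. ?s j z \<noteq> 0" using False by (rule tendsto_imp_eventually_ne)
    then show ?thesis by (rule eventually_mono) simp
  qed simp
  then have "\<forall>\<^sub>F z in nhds w. \<forall>j. ?s j z = 0 \<longrightarrow> ?s j w = 0" by (rule eventually_all_finite)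
  then show ?thesis by (rule eventually_mono) (auto simp: active_set_def split_beta)
qed


section \<open>Global and local optimality\<close>

lemma optimal_value_global_optimizer:
  assumes "global_optimizer g C z"
  shows "optimal_value g C = ereal (g z)"
  unfolding optimal_value_def
proof (rule antisym)
  show "(INF w\<in>C. ereal (g w)) \<le> ereal (g z)"
    using assms by (intro INF_lower) (simp add: global_optimizer_def)
  show "ereal (g z) \<le> (INF w\<in>C. ereal (g w))"
    using assms by (intro INF_greatest) (simp add: global_optimizer_def)
qed

theorem theorem4p1:
  fixes F f :: "(real^'n) \<times> (real^'p) \<Rightarrow> real"
    and I1 :: "'i set"
    and h :: "'i \<Rightarrow> (real^'n) \<times> (real^'p) \<Rightarrow> real"
    and A :: "real^'p^'m"
    and b :: "real^'n \<Rightarrow> real^'m"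
    and J0 :: "'m set set"
    and \<theta> :: "'m set \<Rightarrow> real"
    and u :: "'m set \<Rightarrow> real^'n"
    and v :: "'m set \<Rightarrow> real^'p"
  assumes "finite I1"
    and "real_polynomial_function F"
    and "real_polynomial_function f"
    and "\<forall>i\<in>I1. real_polynomial_function (h i)"
    and "\<forall>j. real_polynomial_function (\<lambda>x. b x $ j)"
    and "\<forall>x. (\<exists>y. (x, y) \<in> constraint_set I1 h A b) \<longrightarrow> lower_solutions f A b x \<noteq> {}"
    and "\<forall>J\<in>branch_indices A. branch_feasible f I1 h A b J = {} \<or>
           (\<exists>z. global_optimizer F (branch_feasible f I1 h A b J) z)"
    and "J0 = {J \<in> branch_indices A. branch_feasible f I1 h A b J \<noteq> {}}"
    and "\<forall>J\<in>J0. ereal (\<theta> J) = optimal_value F (branch_feasible f I1 h A b J)"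
    and "\<forall>J\<in>J0. global_optimizer F (branch_feasible f I1 h A b J) (u J, v J)"
    and "J0 \<noteq> {}"
  shows "ereal (alg_Fmin J0 \<theta>) = optimal_value F (bilevel_feasible f I1 h A b)
    \<and> (\<forall>J\<in>J0. global_optimizer F (bilevel_feasible f I1 h A b) (u J, v J)
                  \<longleftrightarrow> J \<in> alg_J1 J0 \<theta>)
    \<and> (\<forall>J\<in>J0. J \<in> alg_J2 A b J0 \<theta> (\<lambda>J. (u J, v J)) \<longrightarrow>
          local_optimizer F (bilevel_feasible f I1 h A b) (u J, v J)
          \<and> \<not> global_optimizer F (bilevel_feasible f I1 h A b) (u J, v J))"
proof -
  let ?C = "bilevel_feasible f I1 h A b"
  let ?B = "\<lambda>J. branch_feasible f I1 h A b J"
  note f = assms(3) and J0 = assms(8)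
  define w where "w J = (u J, v J)" for J
  have opt: "global_optimizer F (?B J) (w J)" if "J \<in> J0" for J
    using assms(10) that by (simp add: w_def)
  have \<theta>: "\<theta> J = F (w J)" if "J \<in> J0" for J
    using assms(9) that optimal_value_global_optimizer[OF opt[OF that]] by (metis ereal.inject)
  have w_feas: "w J \<in> ?C" if "J \<in> J0" for J
    using opt[OF that] by (simp add: global_optimizer_def branch_feasible_def)
  have near: "\<exists>J'\<in>J0. J' \<subseteq> active_set A b z \<union> J \<and> \<theta> J' \<le> F z" if z_feas: "z \<in> ?C" and J: "J \<in> J0" for z J
  proof -
    obtain x y where z: "z = (x, y)" by (cases z)
    have "J \<in> branch_indices A" using J J0 by blast
    then obtain J' where J': "J' \<in> branch_indices A" "J' \<subseteq> active_set A b z \<union> J" "z \<in> ?B J'"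
      using bilevel_feasible_in_branch_near[OF f z_feas[unfolded z]] z by metis
    then have "J' \<in> J0" using J0 by blast
    then show ?thesis using J' opt[of J'] \<theta>[of J'] by (auto simp: global_optimizer_def)
  qed
  have fin: "finite (\<theta> ` J0)" by simp
  have "alg_Fmin J0 \<theta> \<in> \<theta> ` J0" unfolding alg_Fmin_def using assms(11) by (intro Min_in) auto
  then obtain J\<^sub>m where J\<^sub>m: "J\<^sub>m \<in> J0" "alg_Fmin J0 \<theta> = \<theta> J\<^sub>m" by blast
  have Fmin_le: "alg_Fmin J0 \<theta> \<le> \<theta> J" if "J \<in> J0" for J
    unfolding alg_Fmin_def using that by (intro Min_le[OF fin]) auto
  have Fmin_lower: "alg_Fmin J0 \<theta> \<le> F z" if "z \<in> ?C" for z
    using near[OF that J\<^sub>m(1)] Fmin_le by force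
  have global_iff: "global_optimizer F ?C (w J) \<longleftrightarrow> J \<in> alg_J1 J0 \<theta>" if "J \<in> J0" for J
  proof
    assume "global_optimizer F ?C (w J)"
    then have "\<theta> J \<le> \<theta> J\<^sub>m"
      using w_feas[OF J\<^sub>m(1)] \<theta>[OF J\<^sub>m(1)] \<theta>[OF that] by (simp add: global_optimizer_def)
    then show "J \<in> alg_J1 J0 \<theta>" using that Fmin_le[OF that] J\<^sub>m(2) by (simp add: alg_J1_def)
  next
    assume "J \<in> alg_J1 J0 \<theta>"
    then show "global_optimizer F ?C (w J)"
      using Fmin_lower \<theta>[OF that] w_feas[OF that] by (simp add: global_optimizer_def alg_J1_def)
  qed
  have "global_optimizer F ?C (w J\<^sub>m)"
    using global_iff[OF J\<^sub>m(1)] J\<^sub>m by (simp add: alg_J1_def)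
  then have optimal: "ereal (alg_Fmin J0 \<theta>) = optimal_value F ?C"
    using optimal_value_global_optimizer J\<^sub>m \<theta> by metis
  have locally: "local_optimizer F ?C (w J)" if "J \<in> J0" "J \<in> alg_J2 A b J0 \<theta> w" for J
  proof -
    obtain r where "0 < r"
      and r: "\<And>z. dist z (w J) < r \<Longrightarrow> active_set A b z \<subseteq> active_set A b (w J)"
      using eventually_active_set_subset[OF assms(5), of A "w J"]
      by (auto simp: eventually_nhds_metric)
    have "F (w J) \<le> F z" if z: "z \<in> ?C" "z \<in> ball (w J) r" for z
    proof -
      obtain J' where J': "J' \<in> J0" "J' \<subseteq> active_set A b z \<union> J" "\<theta> J' \<le> F z"
        using near[OF z(1) \<open>J \<in> J0\<close>] by blast
      moreover have "active_set A b z \<subseteq> active_set A b (w J)"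
        using r z(2) by (simp add: dist_commute)
      ultimately have "\<theta> J \<le> \<theta> J'"
        using \<open>J \<in> alg_J2 A b J0 \<theta> w\<close> unfolding alg_J2_def by blast
      with J'(3) \<theta>[OF \<open>J \<in> J0\<close>] show ?thesis by simp
    qed
    then show ?thesis
      using w_feas[OF \<open>J \<in> J0\<close>] \<open>0 < r\<close> by (auto simp: local_optimizer_def global_optimizer_def)
  qed
  have "\<not> global_optimizer F ?C (w J)" if "J \<in> J0" "J \<in> alg_J2 A b J0 \<theta> w" for J
    using that global_iff by (simp add: alg_J2_def)
  with optimal global_iff locally show ?thesis
    unfolding w_def by blast
qed

end
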